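(* Let $(X,T,\mu)$ be a measure preserving transformation on a metric space $X$, with $\mu$ a probability measure. Let $x_0\in X$ be a point such that $\mu(\{x_0\})=0$ and $0<\underline{d}_\mu(x_0)\le\overline{d}_\mu(x_0)<\infty$, and suppose there exist $C,\beta>0$ such that for all small enough $r,\lambda>0$ $$\mu(B_{(1+\lambda)r}(x_0))\le\mu(B_r(x_0))(1+C\lambda^\beta).$$ If the system has polynomial decay of correlations with exponent $p>0$, then $$\limsup_{r\to0}\frac{\log\tau_r(x,x_0)}{-\log\mu(B_r(x_0))}\le1+\frac{2\overline{d}_\mu(x_0)+2}{\underline{d}_\mu(x_0)\,p}$$ holds for $\mu$-almost every $x$.
   Context: $\tau_r(x,x_0)=\min\{n\ge 1: T^n(x)\in B_r(x_0)\}$ is the hitting time of the ball of radius $r$ centered at $x_0$. The upper and lower local dimensions of $\mu$ at $x_0$ are $\overline{d}_\mu(x_0)=\limsup_{r\to0}\frac{\log\mu(B_r(x_0))}{\log r}$ and $\underline{d}_\mu(x_0)=\liminf_{r\to0}\frac{\log\mu(B_r(x_0))}{\log r}$. A system $(X,T,\mu)$ with $\mu$ $T$-invariant has decay of correlations with power law speed with exponent $p$ if there exists $\Phi(n)$ such that for all Lipschitz observables $\phi,\psi:X\to\mathbb{R}$ and all $n$, $$\left|\int \phi\circ T^n\,\psi\,d\mu-\int\phi\,d\mu\int\psi\,d\mu\right|\le\|\phi\|\,\|\psi\|\,\Phi(n),$$ and $\lim_{n\to\infty}\frac{-\log\Phi(n)}{\log n}=p$; here $\|\cdot\|$ is the Lipschitz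 norm (supremum norm plus Lipschitz constant). The metric space $X$ is separable and $\mu$ is a Borel measure. *)

theory Defs
  imports "HOL-Probability.Probability"
begin

(* The logarithm on [0, \<infinity>], with log 0 = -\<infinity> and log \<infinity> = \<infinity>. It replaces the library ln, for
   which ln 0 = 0, wherever the argument may vanish (measure of a ball, decay rate) or be
   infinite (hitting time of a ball that is never reached). Negative arguments are irrelevant. *)
definition log_ext :: "ereal \<Rightarrow> ereal" where
  "log_ext x = (if x = \<infinity> then \<infinity> else if x \<le> 0 then - \<infinity> else ereal (ln (real_of_ereal x)))"

(* The infimum of the empty set is \<infinity> in enat. *)
definition hitting_time :: "('a::metric_space \<Rightarrow> 'a) \<Rightarrow> real \<Rightarrow> 'a \<Rightarrow> 'a \<Rightarrow> enat" where
  "hitting_time T r x x\<^sub>0 = Inf (enat ` {n. n \<ge> 1 \<and> (T ^^ n) x \<in> ball x\<^sub>0 r})"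

definition upper_local_dim :: "'a::metric_space measure \<Rightarrow> 'a \<Rightarrow> ereal" where
  "upper_local_dim M x\<^sub>0 =
     Limsup (at_right 0) (\<lambda>r::real. log_ext (ereal (measure M (ball x\<^sub>0 r))) / ereal (ln r))"

definition lower_local_dim :: "'a::metric_space measure \<Rightarrow> 'a \<Rightarrow> ereal" where
  "lower_local_dim M x\<^sub>0 =
     Liminf (at_right 0) (\<lambda>r::real. log_ext (ereal (measure M (ball x\<^sub>0 r))) / ereal (ln r))"

(* Functions of finite Lipschitz norm. Boundedness is automatic on bounded spaces only. *)
definition lipschitz_observable :: "('a::metric_space \<Rightarrow> real) \<Rightarrow> bool" where
  "lipschitz_observable f \<longleftrightarrow> bounded (range f) \<and> (\<exists>L. L-lipschitz_on UNIV f)"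

(* Supremum norm plus least Lipschitz constant; meaningful for lipschitz_observable f. *)
definition lipschitz_norm :: "('a::metric_space \<Rightarrow> real) \<Rightarrow> real" where
  "lipschitz_norm f = (SUP x. \<bar>f x\<bar>) + Inf {L. L-lipschitz_on UNIV f}"

definition power_law_decay :: "'a::metric_space measure \<Rightarrow> ('a \<Rightarrow> 'a) \<Rightarrow> real \<Rightarrow> bool" where
  "power_law_decay M T p \<longleftrightarrow>
     (\<exists>\<Phi> :: nat \<Rightarrow> real.
        (\<forall>\<phi> \<psi> n. lipschitz_observable \<phi> \<longrightarrow> lipschitz_observable \<psi> \<longrightarrow>
           \<bar>(\<integral>x. \<phi> ((T ^^ n) x) * \<psi> x \<partial>M) - (\<integral>x. \<phi> x \<partial>M) * (\<integral>x. \<psi> x \<partial>M)\<bar>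
             \<le> lipschitz_norm \<phi> * lipschitz_norm \<psi> * \<Phi> n) \<and>
        ((\<lambda>n. - log_ext (ereal (\<Phi> n)) / ereal (ln (real n))) \<longlongrightarrow> ereal p) sequentially)"

end

theory Submission
  imports Defs
begin

text \<open>
  Write \<open>m r\<close> for the measure of the ball of radius \<open>r\<close> around \<open>x\<^sub>0\<close>. The number of visits of an
  orbit to this ball before time \<open>N\<close> has mean \<open>N * m r\<close>. If the visits are nearly uncorrelated,
  the number is concentrated around its mean, so it is positive, that is, the hitting time is at
  most \<open>N\<close>, as soon as \<open>N\<close> is somewhat larger than \<open>1 / m r\<close>.

  To use decay of correlations, the indicator of the ball is replaced by a bump function \<open>f\<close>
  between the indicators of \<open>ball x\<^sub>0 (b * r)\<close> and \<open>ball x\<^sub>0 r\<close>, where \<open>b < 1\<close> is fixed. Its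
  Lipschitz norm is of order \<open>1 / r\<close>. The growth hypothesis on balls, applied with one
  fixed \<open>\<lambda>\<close>, gives \<open>m r \<le> A * m (b * r)\<close> with a constant \<open>A\<close>, so the mean of \<open>f\<close> is comparable
  to \<open>m r\<close>. By Chebyshev's inequality the orbit avoids the ball up to time \<open>N\<close> with probability at
  most of order
  \<open>K / (N * m r) + r\<^sup>-\<^sup>2 * K powr - q / (m r)\<^sup>2\<close>, for every \<open>q < p\<close> and every large \<open>K\<close>
  (\<open>prob_no_visit_le\<close>): pairs of times less than \<open>K\<close> apart are bounded trivially, the others
  by the decay of correlations.

  Let \<open>r powr D < m r < r powr e\<close>, where \<open>D\<close> is slightly above the upper and \<open>e\<close> slightly below the
  lower local dimension. With \<open>K = m r powr - \<kappa>'\<close> and \<open>N = m r powr - (1 + \<kappa>)\<close> the two summands are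
  bounded, up to constant factors, by \<open>r powr (e * (\<kappa> - \<kappa>'))\<close> and \<open>r powr (e * \<kappa>' * q - 2 - 2 * D)\<close>. Both exponents are
  positive if \<open>(2 * D + 2) / (e * q) < \<kappa>' < \<kappa>\<close>, which is where the constant in the theorem comes
  from (\<open>eventually_prob_no_visit_le\<close>). Along the radii \<open>b ^ k\<close> these probabilities are summable,
  and the Borel--Cantelli lemma bounds the hitting times at these radii almost surely
  (\<open>AE_hitting_time_geometric_le\<close>). Since the hitting time is monotone in the radius and \<open>m\<close> changes
  by at most the factor \<open>A\<close> from one radius to the next, the bound passes to all radii
  (\<open>Limsup_hitting_time_le\<close>). Finally \<open>D\<close>, \<open>e\<close>, \<open>q\<close> and \<open>\<kappa>\<close> tend to their limits.
\<close>

section \<open>Second moment bound for the number of visits\<close>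

lemma measure_preserving_funpow:
  assumes "T \<in> measurable M M" "distr M M T = M"
  shows "distr M M (T ^^ n) = M"
proof (induction n)
  case 0
  show ?case by (simp add: distr_id2)
next
  case (Suc n)
  have "distr M M (T ^^ Suc n) = distr (distr M M (T ^^ n)) M T"
    using assms(1) by (simp add: distr_distr measurable_compose_n)
  then show ?case unfolding Suc assms(2) .
qed

lemma integral_funpow:
  fixes f :: "'a \<Rightarrow> real"
  assumes T: "T \<in> measurable M M" "distr M M T = M" and f: "f \<in> borel_measurable M"
  shows "(\<integral>x. f ((T ^^ n) x) \<partial>M) = (\<integral>x. f x \<partial>M)"
proof -
  have "(\<integral>x. f ((T ^^ n) x) \<partial>M) = (\<integral>x. f x \<partial>(distr M M (T ^^ n)))"
    using f T(1) by (simp add: integral_distr measurable_compose_n)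
  then show ?thesis using measure_preserving_funpow[OF T] by simp
qed

lemma integral_lag:
  fixes f :: "'a \<Rightarrow> real"
  assumes T: "T \<in> measurable M M" "distr M M T = M"
    and f: "f \<in> borel_measurable M" and "i \<le> j"
  shows "(\<integral>x. f ((T ^^ i) x) * f ((T ^^ j) x) \<partial>M)
       = (\<integral>x. f ((T ^^ (j - i)) x) * f x \<partial>M)"
proof -
  have "(T ^^ j) x = (T ^^ (j - i)) ((T ^^ i) x)" for x
    using \<open>i \<le> j\<close> by (metis comp_apply funpow_add le_add_diff_inverse2)
  moreover have "(\<lambda>x. f ((T ^^ (j - i)) x) * f x) \<in> borel_measurable M"
    using f T(1) by (intro borel_measurable_times measurable_compose[OF _ f] measurable_compose_n f)
  ultimately show ?thesis
    using integral_funpow[OF T, of "\<lambda>x. f ((T ^^ (j - i)) x) * f x" i]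
    by (simp add: mult.commute)
qed

text \<open>
  The conditional is the distance of \<open>i\<close> and \<open>j\<close>. The bound counts the near-diagonal terms in a
  row of the covariance matrix of the visits.
\<close>

lemma card_near_le:
  fixes i K N :: nat
  shows "card {j \<in> {1..N}. (if i \<le> j then j - i else i - j) < K} \<le> 2 * K"
proof -
  have "{j \<in> {1..N}. (if i \<le> j then j - i else i - j) < K} \<subseteq> {i..<i + K} \<union> {Suc i - K..<Suc i}"
    by (auto split: if_splits)
  then have "card {j \<in> {1..N}. (if i \<le> j then j - i else i - j) < K}
           \<le> card ({i..<i + K} \<union> {Suc i - K..<Suc i})"
    by (intro card_mono) auto
  also have "\<dots> \<le> card {i..<i + K} + card {Suc i - K..<Suc i}" by (rule card_Un_le)
  also have "\<dots> \<le> 2 * K" by simp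
  finally show ?thesis .
qed

text \<open>
  Chebyshev's inequality for the sum of \<open>f\<close> along the orbit: on the event in question the sum
  vanishes, so it deviates from its mean \<open>N * E\<close> by exactly \<open>N * E\<close>. The variance is a double sum of
  covariances. Each is at most \<open>E\<close>, because \<open>f\<close> takes values between 0 and 1, and at most \<open>\<epsilon>\<close> for
  times at least \<open>K\<close> apart. A lower bound \<open>a\<close> for the mean \<open>E\<close> is what the geometry provides later.
\<close>

lemma (in prob_space) prob_no_visit_le:
  fixes f :: "'a \<Rightarrow> real" and a \<epsilon> :: real and K N :: nat
  assumes T: "T \<in> measurable M M" "distr M M T = M"
    and f: "f \<in> borel_measurable M" and f01: "\<And>x. 0 \<le> f x" "\<And>x. f x \<le> 1"
    and pos: "0 < a" "a \<le> expectation f" and N: "0 < N" and \<epsilon>: "0 \<le> \<epsilon>"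
    and dec: "\<And>n. K \<le> n \<Longrightarrow> \<bar>expectation (\<lambda>x. f ((T ^^ n) x) * f x) - (expectation f)\<^sup>2\<bar> \<le> \<epsilon>"
  shows "prob {x \<in> space M. \<forall>n\<in>{1..N}. f ((T ^^ n) x) = 0} \<le> 2 * K / (N * a) + \<epsilon> / a\<^sup>2"
proof -
  define E where "E = expectation f"
  define g where "g n x = f ((T ^^ n) x)" for n x
  define h where "h x = (\<Sum>i=1..N. g i x - E)" for x
  define A where "A = {x \<in> space M. \<forall>n\<in>{1..N}. f ((T ^^ n) x) = 0}"
  have E: "a \<le> E" "0 < E" using pos by (auto simp: E_def)
  have gm [measurable]: "g n \<in> borel_measurable M" for n
    unfolding g_def using T(1) by (intro measurable_compose[OF _ f] measurable_compose_n)
  have Eg: "expectation (g n) = E" for n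
    unfolding g_def E_def by (rule integral_funpow[OF T f])
  have g01: "0 \<le> g n x" "g n x \<le> 1" for n x using f01 by (auto simp: g_def)
  have ig: "integrable M (g n)" for n
    using g01 by (intro integrable_const_bound[of _ 1]) auto
  have igg: "integrable M (\<lambda>x. g i x * g j x)" for i j
    using g01 by (intro integrable_const_bound[of _ 1]) (auto simp: abs_mult intro!: mult_le_one)
  have cov: "expectation (\<lambda>x. (g i x - E) * (g j x - E)) = expectation (\<lambda>x. g i x * g j x) - E\<^sup>2" for i j
  proof -
    have "expectation (\<lambda>x. (g i x - E) * (g j x - E))
        = expectation (\<lambda>x. g i x * g j x - E * g i x - E * g j x + E * E)"
      by (simp add: algebra_simps)
    also have "\<dots> = expectation (\<lambda>x. g i x * g j x) - E * E - E * E + E * E"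
      using ig igg by (simp add: Eg prob_space)
    finally show ?thesis by (simp add: power2_eq_square)
  qed
  have icov: "integrable M (\<lambda>x. (g i x - E) * (g j x - E))" for i j
  proof -
    have "integrable M (\<lambda>x. g i x * g j x - E * g i x - E * g j x + E * E)"
      using ig igg by auto
    then show ?thesis by (simp add: algebra_simps)
  qed
  (* The factor g j only makes the product smaller, as 0 \<le> g j \<le> 1. *)
  have near: "expectation (\<lambda>x. g i x * g j x) \<le> E" for i j
  proof -
    have "expectation (\<lambda>x. g i x * g j x) \<le> expectation (g i)"
      using g01 by (intro integral_mono igg ig) (simp add: mult_left_le)
    then show ?thesis by (simp add: Eg)
  qed
  have far: "expectation (\<lambda>x. g i x * g j x) - E\<^sup>2 \<le> \<epsilon>"
    if "K \<le> (if i \<le> j then j - i else i - j)" for i j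
  proof (cases "i \<le> j")
    case True
    then show ?thesis
      using integral_lag[OF T f, of i j] dec[of "j - i"] that by (simp add: g_def E_def)
  next
    case False
    then show ?thesis
      using integral_lag[OF T f, of j i] dec[of "i - j"] that
      by (simp add: g_def E_def mult.commute)
  qed
  have cov_le: "expectation (\<lambda>x. (g i x - E) * (g j x - E))
      \<le> (if (if i \<le> j then j - i else i - j) < K then E else 0) + \<epsilon>" for i j
  proof (cases "(if i \<le> j then j - i else i - j) < K")
    case True
    have "expectation (\<lambda>x. g i x * g j x) - E\<^sup>2 \<le> E + \<epsilon>"
      using near[of i j] \<epsilon> zero_le_power2[of E] by linarith
    then show ?thesis by (simp add: cov True)
  next
    case False
    then show ?thesis using far[of i j] by (simp add: cov)
  qed
  have h2: "(h x)\<^sup>2 = (\<Sum>i=1..N. \<Sum>j=1..N. (g i x - E) * (g j x - E))" for x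
    unfolding h_def power2_eq_square sum_product ..
  have ih: "integrable M (\<lambda>x. (h x)\<^sup>2)"
    unfolding h2 by (intro Bochner_Integration.integrable_sum icov)
  have "expectation (\<lambda>x. (h x)\<^sup>2)
      = (\<Sum>i=1..N. \<Sum>j=1..N. expectation (\<lambda>x. (g i x - E) * (g j x - E)))"
    unfolding h2 by (simp add: Bochner_Integration.integral_sum icov Bochner_Integration.integrable_sum)
  also have "\<dots> \<le> (\<Sum>i=1..N. \<Sum>j=1..N.
      (if (if i \<le> j then j - i else i - j) < K then E else 0) + \<epsilon>)"
    by (intro sum_mono cov_le)
  also have "\<dots> = (\<Sum>i=1..N. card {j \<in> {1..N}. (if i \<le> j then j - i else i - j) < K} * E + N * \<epsilon>)"
    by (simp add: sum.distrib sum.If_cases Int_def)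
  also have "\<dots> \<le> (\<Sum>i=1..N. real (2 * K) * E + N * \<epsilon>)"
    using E(2) by (intro sum_mono add_right_mono mult_right_mono of_nat_mono card_near_le) auto
  also have "\<dots> = N * (2 * K * E) + (real N)\<^sup>2 * \<epsilon>"
    by (simp add: algebra_simps power2_eq_square)
  finally have var: "expectation (\<lambda>x. (h x)\<^sup>2) \<le> N * (2 * K * E) + (real N)\<^sup>2 * \<epsilon>" .
  have Am: "A \<in> sets M"
    unfolding A_def g_def[symmetric] by measurable
  have "(N * E)\<^sup>2 * prob A = expectation (\<lambda>x. (N * E)\<^sup>2 * indicator A x)"
    using Am by simp
  also have "\<dots> \<le> expectation (\<lambda>x. (h x)\<^sup>2)"
  proof (intro integral_mono ih)
    show "integrable M (\<lambda>x. (N * E)\<^sup>2 * indicator A x :: real)"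
      using Am by (intro integrable_mult_right) (auto simp: emeasure_eq_measure)
    show "(N * E)\<^sup>2 * indicator A x \<le> (h x)\<^sup>2" for x
    proof (cases "x \<in> A")
      case True
      then have "h x = - (N * E)" by (simp add: h_def A_def g_def)
      then show ?thesis by (simp add: True)
    qed simp
  qed
  finally have "(N * E)\<^sup>2 * prob A \<le> N * (2 * K * E) + (real N)\<^sup>2 * \<epsilon>" using var by linarith
  then have "prob A \<le> (N * (2 * K * E) + (real N)\<^sup>2 * \<epsilon>) / (N * E)\<^sup>2"
    using N E by (simp add: pos_le_divide_eq mult.commute)
  also have "\<dots> = 2 * K / (N * E) + \<epsilon> / E\<^sup>2"
    using N E by (simp add: add_divide_distrib power2_eq_square)
  also have "\<dots> \<le> 2 * K / (N * a) + \<epsilon> / a\<^sup>2"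
    using N E pos \<epsilon> by (intro add_mono divide_left_mono mult_left_mono power_mono mult_pos_pos) auto
  finally show ?thesis unfolding A_def .
qed

section \<open>Lipschitz bump functions\<close>

text \<open>
  For \<open>s < r\<close>, a Lipschitz function between the indicators of the balls of radius \<open>s\<close> and \<open>r\<close>.
\<close>

definition bump :: "'a::metric_space \<Rightarrow> real \<Rightarrow> real \<Rightarrow> 'a \<Rightarrow> real" where
  "bump x\<^sub>0 s r x = max 0 (min 1 ((r - dist x\<^sub>0 x) / (r - s)))"

lemma bump_bounds: "0 \<le> bump x\<^sub>0 s r x" "bump x\<^sub>0 s r x \<le> 1"
  by (auto simp: bump_def)

lemma bump_eq_1: "s < r \<Longrightarrow> x \<in> ball x\<^sub>0 s \<Longrightarrow> bump x\<^sub>0 s r x = 1"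
  by (simp add: bump_def)

lemma bump_support:
  assumes "s < r" "bump x\<^sub>0 s r x \<noteq> 0"
  shows "x \<in> ball x\<^sub>0 r"
proof (rule ccontr)
  assume "x \<notin> ball x\<^sub>0 r"
  then have "(r - dist x\<^sub>0 x) / (r - s) \<le> 0"
    using assms(1) by (intro divide_nonpos_pos) auto
  then show False using assms(2) by (simp add: bump_def)
qed

lemma lipschitz_on_bump:
  assumes "s < r"
  shows "(1 / (r - s))-lipschitz_on UNIV (bump x\<^sub>0 s r)"
proof (rule lipschitz_onI)
  fix x y
  have "\<bar>bump x\<^sub>0 s r x - bump x\<^sub>0 s r y\<bar>
      \<le> \<bar>(r - dist x\<^sub>0 x) / (r - s) - (r - dist x\<^sub>0 y) / (r - s)\<bar>"
    unfolding bump_def by linarith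
  also have "\<dots> = \<bar>dist x\<^sub>0 y - dist x\<^sub>0 x\<bar> / (r - s)"
    using assms by (simp flip: diff_divide_distrib)
  also have "\<dots> \<le> dist x y / (r - s)"
    using assms by (intro divide_right_mono) (metric, simp)
  finally show "dist (bump x\<^sub>0 s r x) (bump x\<^sub>0 s r y) \<le> 1 / (r - s) * dist x y"
    by (simp add: dist_real_def)
qed (use assms in simp)

lemma lipschitz_norm_nonneg:
  assumes "lipschitz_observable f"
  shows "0 \<le> lipschitz_norm f"
proof -
  have "bdd_above (range (\<lambda>x. \<bar>f x\<bar>))"
    using assms by (auto simp: lipschitz_observable_def bounded_iff bdd_above_def)
  then have "0 \<le> (SUP x. \<bar>f x\<bar>)"
    by (meson UNIV_I abs_ge_zero cSUP_upper2)
  moreover have "0 \<le> Inf {L. L-lipschitz_on UNIV f}"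
    using assms by (intro cInf_greatest) (auto simp: lipschitz_observable_def lipschitz_on_nonneg)
  ultimately show ?thesis by (simp add: lipschitz_norm_def)
qed

lemma lipschitz_norm_le:
  assumes "\<And>x. \<bar>f x\<bar> \<le> B" "L-lipschitz_on UNIV f"
  shows "lipschitz_norm f \<le> B + L"
  unfolding lipschitz_norm_def
proof (rule add_mono)
  show "(SUP x. \<bar>f x\<bar>) \<le> B" using assms(1) by (intro cSUP_least) auto
  have "bdd_below {L. L-lipschitz_on UNIV f}"
    by (intro bdd_belowI[of _ 0]) (auto simp: lipschitz_on_nonneg)
  then show "Inf {L. L-lipschitz_on UNIV f} \<le> L" using assms(2) by (intro cInf_lower) auto
qed

lemma lipschitz_observable_bump:
  assumes "s < r"
  shows "lipschitz_observable (bump x\<^sub>0 s r)"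
  unfolding lipschitz_observable_def
proof
  show "bounded (range (bump x\<^sub>0 s r))"
    by (rule boundedI[of _ 1]) (auto simp: bump_bounds)
  show "\<exists>L. L-lipschitz_on UNIV (bump x\<^sub>0 s r)"
    using lipschitz_on_bump[OF assms] by blast
qed

lemma lipschitz_norm_bump_le: "s < r \<Longrightarrow> lipschitz_norm (bump x\<^sub>0 s r) \<le> 1 + 1 / (r - s)"
  using bump_bounds[of x\<^sub>0 s r] by (intro lipschitz_norm_le lipschitz_on_bump) auto

lemma borel_measurable_bump: "s < r \<Longrightarrow> bump x\<^sub>0 s r \<in> borel_measurable borel"
  by (intro borel_measurable_continuous_onI lipschitz_on_continuous_on[OF lipschitz_on_bump])

section \<open>Hitting times, local dimensions and decay rates\<close>

lemma hitting_time_le: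
  assumes "1 \<le> n" "(T ^^ n) x \<in> ball x\<^sub>0 r" "n \<le> N"
  shows "hitting_time T r x x\<^sub>0 \<le> enat N"
proof -
  have "hitting_time T r x x\<^sub>0 \<le> enat n"
    unfolding hitting_time_def using assms by (intro Inf_lower) auto
  then show ?thesis using assms(3) by (meson dual_order.trans enat_ord_simps(1))
qed

lemma hitting_time_antimono:
  assumes "s \<le> r"
  shows "hitting_time T r x x\<^sub>0 \<le> hitting_time T s x x\<^sub>0"
  unfolding hitting_time_def using assms by (intro Inf_superset_mono) auto

lemma log_ext_mono: "x \<le> y \<Longrightarrow> log_ext x \<le> log_ext y"
  by (cases x; cases y) (auto simp: log_ext_def zero_ereal_def)

lemma log_ext_real: "0 < y \<Longrightarrow> log_ext (ereal y) = ereal (ln y)"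
  by (simp add: log_ext_def)

text \<open>
  Dividing by \<open>ln r < 0\<close> reverses the inequalities, so the lower dimension bounds the measure from
  above. The ball has positive measure because otherwise the quotient is \<open>\<infinity>\<close>, which the bound by
  \<open>D\<close> excludes.
\<close>

lemma eventually_measure_ball_between:
  fixes e D :: real
  assumes e: "ereal e < lower_local_dim M x\<^sub>0" and D: "upper_local_dim M x\<^sub>0 < ereal D"
  shows "\<forall>\<^sub>F r in at_right 0.
    r powr D < measure M (ball x\<^sub>0 r) \<and> measure M (ball x\<^sub>0 r) < r powr e"
proof -
  have "\<forall>\<^sub>F r in at_right 0. ereal e < log_ext (ereal (measure M (ball x\<^sub>0 r))) / ereal (ln r)"
    using e unfolding lower_local_dim_def by (rule less_LiminfD)
  moreover have "\<forall>\<^sub>F r in at_right 0. log_ext (ereal (measure M (ball x\<^sub>0 r))) / ereal (ln r) < ereal D"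
    using D unfolding upper_local_dim_def by (rule Limsup_lessD)
  moreover have "\<forall>\<^sub>F r::real in at_right 0. r \<in> {0<..<1}"
    by (rule eventually_at_right_real) simp
  ultimately show ?thesis
  proof eventually_elim
    case (elim r)
    define m where "m = measure M (ball x\<^sub>0 r)"
    have r: "0 < r" "ln r < 0" using elim(3) by auto
    have "m \<noteq> 0" using elim(2) r by (auto simp: m_def log_ext_def divide_ereal_def)
    then have m: "0 < m" by (simp add: m_def zero_less_measure_iff)
    have "e < ln m / ln r" "ln m / ln r < D"
      using elim(1,2) m r by (simp_all add: log_ext_real flip: m_def)
    then have "ln m < e * ln r" "D * ln r < ln m"
      using r by (simp_all add: divide_simps mult.commute)
    then have "ln m < ln (r powr e)" "ln (r powr D) < ln m" using r by (simp_all add: ln_powr)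
    then show ?case using m r(1) by (metis ln_less_cancel_iff m_def powr_gt_zero less_irrefl)
  qed
qed

lemma eventually_rate_le:
  assumes lim: "((\<lambda>n. - log_ext (ereal (\<Phi> n)) / ereal (ln (real n))) \<longlongrightarrow> ereal p) sequentially"
    and "q < p"
  shows "\<forall>\<^sub>F n in sequentially. \<Phi> n \<le> real n powr - q"
proof -
  have "\<forall>\<^sub>F n in sequentially. ereal q < - log_ext (ereal (\<Phi> n)) / ereal (ln (real n))"
    using lim by (rule order_tendstoD) (use \<open>q < p\<close> in simp)
  then show ?thesis using eventually_gt_at_top[of 1]
  proof eventually_elim
    case (elim n)
    have n: "0 < ln (real n)" using elim(2) by simp
    show ?case
    proof (cases "0 < \<Phi> n")
      case True
      then have "q < - ln (\<Phi> n) / ln (real n)" using elim n by (simp add: log_ext_real)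
      then have "ln (\<Phi> n) < ln (real n powr - q)"
        using n by (simp add: ln_powr divide_simps mult.commute)
      moreover have "0 < real n powr - q" using elim(2) by simp
      ultimately show ?thesis using True by (metis ln_less_cancel_iff less_imp_le)
    qed (use order_trans[OF _ powr_ge_zero] in fastforce)
  qed
qed

section \<open>Avoiding small balls is unlikely\<close>

text \<open>
  The growth hypothesis at the single value \<open>l = \<epsilon> / 2\<close> compares \<open>m\<close> at \<open>r\<close> and at \<open>r / (1 + l)\<close>.
  Small values of \<open>l\<close> are not wanted here: a fixed ratio of radii makes the Lipschitz norm of the
  bump functions inversely proportional to the radius.
\<close>

lemma doubling_at_point:
  fixes m :: "real \<Rightarrow> real" and \<epsilon> C \<beta> :: real
  assumes "0 < \<epsilon>" "0 < C"
    and "\<forall>r l. 0 < r \<and> r < \<epsilon> \<and> 0 < l \<and> l < \<epsilon> \<longrightarrow> m ((1 + l) * r) \<le> m r * (1 + C * l powr \<beta>)"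
  obtains b A where "0 < b" "b < 1" "0 < A" "\<forall>\<^sub>F r in at_right 0. m r \<le> A * m (b * r)"
proof -
  define l where "l = \<epsilon> / 2"
  have l: "0 < l" "l < \<epsilon>" using assms(1) by (auto simp: l_def)
  have "\<forall>\<^sub>F r in at_right 0. r \<in> {0<..<\<epsilon>}" using assms(1) by (intro eventually_at_right_real)
  then have "\<forall>\<^sub>F r in at_right 0. m r \<le> (1 + C * l powr \<beta>) * m (inverse (1 + l) * r)"
  proof eventually_elim
    case (elim r)
    define s where "s = inverse (1 + l) * r"
    have r: "r = (1 + l) * s" using l by (simp add: s_def)
    have "0 < s" using elim l by (simp add: s_def)
    then have "s \<le> r" using l by (simp add: r)
    then have "s < \<epsilon>" using elim by simp
    then have "m ((1 + l) * s) \<le> m s * (1 + C * l powr \<beta>)"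
      using assms(3) \<open>0 < s\<close> l by blast
    then show ?case using r s_def by (metis mult.commute)
  qed
  moreover have "0 < 1 + C * l powr \<beta>" using assms(2) by (simp add: add_pos_nonneg)
  moreover have "inverse (1 + l) < 1" using l by (simp add: inverse_less_1_iff)
  ultimately show thesis using l by (intro that[of "inverse (1 + l)"]) auto
qed

lemma eventually_powr_less:
  fixes e c :: real
  assumes "0 < e" "0 < c"
  shows "\<forall>\<^sub>F r in at_right 0. r powr e < c"
proof -
  have "((\<lambda>r::real. r powr e) \<longlongrightarrow> 0 powr e) (at_right 0)"
    using assms eventually_at_right_less[of "0::real"]
    by (intro tendsto_powr' tendsto_ident_at tendsto_const) (auto elim: eventually_mono)
  then show ?thesis using assms by (auto dest: order_tendstoD(2))
qed

text \<open>
  The two exponents in the definition of \<open>\<delta>\<close> come from the two summands of the second moment bound.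
  The first one needs \<open>\<kappa>' < \<kappa>\<close>, the second one \<open>(2 * D + 2) / (e * q) < \<kappa>'\<close>: a factor
  \<open>r powr - 2\<close> is due to the squared Lipschitz norm, and \<open>r powr (- 2 * D)\<close> to the squared mean in
  the denominator.
\<close>

lemma eventually_prob_no_visit_le:
  fixes M :: "'a::metric_space measure" and b A e D q \<kappa> :: real
  assumes M: "prob_space M" "sets M = sets borel"
    and T: "T \<in> measurable M M" "distr M M T = M"
    and b: "0 < b" "b < 1" and "0 < A" "0 < e" "0 < D" "0 < q"
    and growth: "\<forall>\<^sub>F r in at_right 0. measure M (ball x\<^sub>0 r) \<le> A * measure M (ball x\<^sub>0 (b * r))"
    and between: "\<forall>\<^sub>F r in at_right 0.
      r powr D < measure M (ball x\<^sub>0 r) \<and> measure M (ball x\<^sub>0 r) < r powr e"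
    and dec: "\<And>\<phi> \<psi> n. lipschitz_observable \<phi> \<Longrightarrow> lipschitz_observable \<psi> \<Longrightarrow>
      \<bar>(\<integral>x. \<phi> ((T ^^ n) x) * \<psi> x \<partial>M) - (\<integral>x. \<phi> x \<partial>M) * (\<integral>x. \<psi> x \<partial>M)\<bar>
        \<le> lipschitz_norm \<phi> * lipschitz_norm \<psi> * \<Phi> n"
    and rate: "\<forall>\<^sub>F n in sequentially. \<Phi> n \<le> real n powr - q"
    and \<kappa>: "(2 * D + 2) / (e * q) < \<kappa>"
  obtains W \<delta> where "0 < \<delta>" "\<forall>\<^sub>F r in at_right 0.
    measure M {x \<in> space M. \<forall>n\<in>{1..nat \<lceil>measure M (ball x\<^sub>0 r) powr - (1 + \<kappa>)\<rceil>}.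
      (T ^^ n) x \<notin> ball x\<^sub>0 r} \<le> W * r powr \<delta>"
proof -
  interpret prob_space M by (rule M)
  (* G / r bounds the Lipschitz norm of the bump function. *)
  define G where "G = 1 + 1 / (1 - b)"
  obtain \<kappa>' where \<kappa>': "(2 * D + 2) / (e * q) < \<kappa>'" "\<kappa>' < \<kappa>" using dense[OF \<kappa>] by auto
  have \<kappa>'_pos: "0 < \<kappa>'"
    using \<kappa>'(1) \<open>0 < e\<close> \<open>0 < D\<close> \<open>0 < q\<close> by (intro less_trans[OF _ \<kappa>'(1)]) auto
  define \<delta> where "\<delta> = min (e * (\<kappa> - \<kappa>')) (e * \<kappa>' * q - 2 - 2 * D)"
  have "2 * D + 2 < e * \<kappa>' * q"
    using \<kappa>'(1) \<open>0 < e\<close> \<open>0 < q\<close> by (simp add: divide_simps mult_ac)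
  then have "0 < \<delta>" using \<kappa>' \<open>0 < e\<close> by (simp add: \<delta>_def)
  obtain n\<^sub>0 where n\<^sub>0: "\<And>n. n\<^sub>0 \<le> n \<Longrightarrow> \<Phi> n \<le> real n powr - q"
    using rate by (auto simp: eventually_sequentially)
  (* For these r the threshold K = m r powr - \<kappa>' exceeds n\<^sub>0, so the rate applies from K on. *)
  have "\<forall>\<^sub>F r in at_right 0. r powr (e * \<kappa>') < 1 / (real n\<^sub>0 + 1)"
    using \<open>0 < e\<close> \<kappa>'_pos by (intro eventually_powr_less) auto
  moreover have "\<forall>\<^sub>F r::real in at_right 0. r \<in> {0<..<1}"
    by (rule eventually_at_right_real) simp
  ultimately have "\<forall>\<^sub>F r in at_right 0.
    measure M {x \<in> space M. \<forall>n\<in>{1..nat \<lceil>measure M (ball x\<^sub>0 r) powr - (1 + \<kappa>)\<rceil>}.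
      (T ^^ n) x \<notin> ball x\<^sub>0 r} \<le> (4 * A + G\<^sup>2 * A\<^sup>2) * r powr \<delta>"
    using growth between
  proof eventually_elim
    case (elim r)
    define m where "m = measure M (ball x\<^sub>0 r)"
    define f where "f = bump x\<^sub>0 (b * r) r"
    define N where "N = nat \<lceil>m powr - (1 + \<kappa>)\<rceil>"
    define K where "K = nat \<lceil>m powr - \<kappa>'\<rceil>"
    define \<epsilon> where "\<epsilon> = (G / r)\<^sup>2 * m powr (\<kappa>' * q)"
    have r: "0 < r" "r < 1" using elim(2) by auto
    have br: "b * r < r" using b r by simp
    have m: "r powr D < m" "m < r powr e" using elim(4) by (auto simp: m_def)
    have m0: "0 < m" using m(1) powr_ge_zero[of r D] by linarith
    have m1: "m < 1" using m(2) powr_le1[of e r] r \<open>0 < e\<close> by linarith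
    have ball_m: "ball x\<^sub>0 s \<in> sets M" for s using M(2) by simp
    have f_m: "f \<in> borel_measurable M"
      unfolding f_def using borel_measurable_bump[OF br] M(2) measurable_cong_sets by blast
    have f01: "0 \<le> f x" "f x \<le> 1" for x by (auto simp: f_def bump_bounds)
    have f_int: "integrable M f"
      using f01 f_m by (intro integrable_const_bound[of _ 1]) auto
    have f_lip: "lipschitz_observable f" unfolding f_def using br by (rule lipschitz_observable_bump)
    have "lipschitz_norm f \<le> 1 + 1 / (r - b * r)"
      unfolding f_def using br by (rule lipschitz_norm_bump_le)
    also have "\<dots> \<le> 1 / r + 1 / (r - b * r)" using r by simp
    also have "\<dots> = G / r" using r b by (simp add: G_def field_simps)
    finally have f_norm: "lipschitz_norm f \<le> G / r" .
    have "m / A \<le> measure M (ball x\<^sub>0 (b * r))"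
      using elim(3) \<open>0 < A\<close> by (simp add: m_def divide_simps mult.commute)
    also have "\<dots> = expectation (indicator (ball x\<^sub>0 (b * r)))" using ball_m by simp
    also have "\<dots> \<le> expectation f"
    proof (rule integral_mono[OF _ f_int])
      show "integrable M (indicator (ball x\<^sub>0 (b * r)) :: 'a \<Rightarrow> real)"
        using ball_m by (auto simp: emeasure_eq_measure)
      show "indicator (ball x\<^sub>0 (b * r)) x \<le> f x" for x
        using bump_eq_1[OF br, of x x\<^sub>0] f01[of x] by (auto simp: f_def indicator_def)
    qed
    finally have Ef: "m / A \<le> expectation f" .
    have Kq: "m powr - \<kappa>' \<le> K" by (simp add: K_def)
    have "m powr - \<kappa>' \<ge> 1" using m0 m1 \<kappa>'_pos by (simp add: powr_minus powr_le1 one_le_inverse)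
    then have K_le: "K \<le> 2 * m powr - \<kappa>'" unfolding K_def by linarith
    have N_ge: "m powr - (1 + \<kappa>) \<le> N" by (simp add: N_def)
    have "0 < m powr - (1 + \<kappa>)" using m0 by simp
    then have N0: "0 < N" using N_ge by linarith
    have "m powr \<kappa>' \<le> (r powr e) powr \<kappa>'" using m m0 \<kappa>'_pos by (intro powr_mono2) auto
    also have "\<dots> < 1 / (real n\<^sub>0 + 1)" using elim(1) by (simp add: powr_powr)
    finally have "real n\<^sub>0 + 1 < m powr - \<kappa>'"
      using m0 by (simp add: powr_minus field_simps)
    then have K_n\<^sub>0: "n\<^sub>0 \<le> K" using Kq by linarith
    have cov: "\<bar>expectation (\<lambda>x. f ((T ^^ n) x) * f x) - (expectation f)\<^sup>2\<bar> \<le> \<epsilon>"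
      if "K \<le> n" for n
    proof -
      have "\<bar>expectation (\<lambda>x. f ((T ^^ n) x) * f x) - (expectation f)\<^sup>2\<bar>
          \<le> lipschitz_norm f * lipschitz_norm f * \<Phi> n"
        using dec[OF f_lip f_lip, of n] by (simp add: power2_eq_square)
      also have "\<dots> \<le> lipschitz_norm f * lipschitz_norm f * real n powr - q"
        using n\<^sub>0[of n] K_n\<^sub>0 that by (intro mult_left_mono) auto
      also have "\<dots> \<le> (G / r)\<^sup>2 * real n powr - q"
        unfolding power2_eq_square using f_norm lipschitz_norm_nonneg[OF f_lip]
        by (intro mult_right_mono mult_mono) auto
      also have "real n powr - q \<le> (m powr - \<kappa>') powr - q"
        using Kq that m0 \<open>0 < q\<close> by (intro powr_mono2') auto
      then have "(G / r)\<^sup>2 * real n powr - q \<le> \<epsilon>"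
        unfolding \<epsilon>_def by (intro mult_left_mono) (auto simp: powr_powr)
      finally show ?thesis .
    qed
    have "prob {x \<in> space M. \<forall>n\<in>{1..N}. (T ^^ n) x \<notin> ball x\<^sub>0 r}
        \<le> prob {x \<in> space M. \<forall>n\<in>{1..N}. f ((T ^^ n) x) = 0}"
    proof (intro finite_measure_mono)
      show "{x \<in> space M. \<forall>n\<in>{1..N}. (T ^^ n) x \<notin> ball x\<^sub>0 r}
          \<subseteq> {x \<in> space M. \<forall>n\<in>{1..N}. f ((T ^^ n) x) = 0}"
        using bump_support[OF br] unfolding f_def by blast
      have "(\<lambda>x. f ((T ^^ n) x)) \<in> borel_measurable M" for n
        using T(1) f_m by (intro measurable_compose[OF _ f_m] measurable_compose_n)
      then show "{x \<in> space M. \<forall>n\<in>{1..N}. f ((T ^^ n) x) = 0} \<in> events" by measurable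
    qed
    also have "\<dots> \<le> 2 * K / (N * (m / A)) + \<epsilon> / (m / A)\<^sup>2"
      using N0 m0 \<open>0 < A\<close>
      by (intro prob_no_visit_le T f_m f01 Ef cov) (auto simp: \<epsilon>_def)
    also have "2 * K / (N * (m / A)) \<le> 4 * A * r powr \<delta>"
    proof -
      have "2 * K / (N * (m / A)) \<le> 2 * (2 * m powr - \<kappa>') / (m powr - (1 + \<kappa>) * (m / A))"
        using K_le N_ge m0 \<open>0 < A\<close> by (intro frac_le mult_mono) auto
      also have "m powr - (1 + \<kappa>) * (m / A) = m powr - \<kappa> / A"
        using m0 by (simp add: powr_diff powr_minus field_simps powr_add)
      also have "2 * (2 * m powr - \<kappa>') / (m powr - \<kappa> / A) = 4 * A * m powr (\<kappa> - \<kappa>')"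
        using m0 by (simp add: powr_diff powr_minus field_simps)
      also have "m powr (\<kappa> - \<kappa>') \<le> (r powr e) powr (\<kappa> - \<kappa>')"
        using m m0 \<kappa>' by (intro powr_mono2) auto
      also have "\<dots> \<le> r powr \<delta>"
        unfolding powr_powr using r by (intro powr_mono') (auto simp: \<delta>_def)
      finally show ?thesis using \<open>0 < A\<close> by simp
    qed
    also have "\<epsilon> / (m / A)\<^sup>2 \<le> G\<^sup>2 * A\<^sup>2 * r powr \<delta>"
    proof -
      have "m powr (\<kappa>' * q) \<le> (r powr e) powr (\<kappa>' * q)"
        using m m0 \<kappa>'_pos \<open>0 < q\<close> by (intro powr_mono2) auto
      moreover have "r powr D * r powr D \<le> m\<^sup>2"
        unfolding power2_eq_square using m m0 by (intro mult_mono) auto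
      ultimately have "m powr (\<kappa>' * q) / (r\<^sup>2 * m\<^sup>2)
          \<le> (r powr e) powr (\<kappa>' * q) / (r\<^sup>2 * (r powr D * r powr D))"
        using r by (intro frac_le mult_left_mono) auto
      also have "\<dots> = r powr (e * \<kappa>' * q - 2 - 2 * D)"
        using r by (simp add: powr_powr powr_diff powr_add[symmetric] mult_ac)
      also have "\<dots> \<le> r powr \<delta>" using r by (intro powr_mono') (auto simp: \<delta>_def)
      finally have "G\<^sup>2 * A\<^sup>2 * (m powr (\<kappa>' * q) / (r\<^sup>2 * m\<^sup>2)) \<le> G\<^sup>2 * A\<^sup>2 * r powr \<delta>"
        by (intro mult_left_mono) auto
      then show ?thesis by (simp add: \<epsilon>_def power_divide mult_ac)
    qed
    finally show ?case by (simp add: N_def m_def algebra_simps)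
  qed
  with \<open>0 < \<delta>\<close> show thesis by (rule that)
qed

section \<open>From geometric radii to all radii\<close>

lemma AE_hitting_time_geometric_le:
  fixes M :: "'a::metric_space measure" and b W \<delta> \<kappa> :: real and N :: "real \<Rightarrow> nat"
  assumes M: "prob_space M" "sets M = sets borel" and T: "T \<in> measurable M M"
    and b: "0 < b" "b < 1" and \<delta>: "0 < \<delta>"
    and prob: "\<forall>\<^sub>F r in at_right 0.
      measure M {x \<in> space M. \<forall>n\<in>{1..N r}. (T ^^ n) x \<notin> ball x\<^sub>0 r} \<le> W * r powr \<delta>"
  shows "AE x in M. \<forall>\<^sub>F k in sequentially. hitting_time T (b ^ k) x x\<^sub>0 \<le> enat (N (b ^ k))"
proof -
  interpret prob_space M by (rule M)
  define A where "A k = {x \<in> space M. \<forall>n\<in>{1..N (b ^ k)}. (T ^^ n) x \<notin> ball x\<^sub>0 (b ^ k)}" for k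
  have Am: "A k \<in> sets M" for k
  proof -
    have [measurable]: "{x \<in> space M. (T ^^ n) x \<in> ball x\<^sub>0 (b ^ k)} \<in> sets M" for n
    proof -
      have "(T ^^ n) -` ball x\<^sub>0 (b ^ k) \<inter> space M \<in> sets M"
        using M(2) by (intro measurable_sets[OF measurable_compose_n[OF T]]) simp
      moreover have "(T ^^ n) -` ball x\<^sub>0 (b ^ k) \<inter> space M = {x \<in> space M. (T ^^ n) x \<in> ball x\<^sub>0 (b ^ k)}"
        by auto
      ultimately show ?thesis by simp
    qed
    show ?thesis unfolding A_def by measurable
  qed
  have lim: "filterlim (\<lambda>k. b ^ k) (at_right 0) sequentially"
    using b by (intro tendsto_imp_filterlim_at_right LIMSEQ_realpow_zero) auto
  have geometric: "(b ^ k) powr \<delta> = (b powr \<delta>) ^ k" for k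
  proof -
    have "(b ^ k) powr \<delta> = (b powr real k) powr \<delta>" using b by (simp only: powr_realpow)
    also have "\<dots> = (b powr \<delta>) powr real k" by (simp only: powr_powr mult.commute)
    also have "\<dots> = (b powr \<delta>) ^ k" using b by (intro powr_realpow) simp
    finally show ?thesis .
  qed
  have "\<forall>\<^sub>F k in sequentially. prob (A k) \<le> W * (b powr \<delta>) ^ k"
    using eventually_compose_filterlim[OF prob lim] by (simp add: A_def geometric)
  moreover have "summable (\<lambda>k. W * (b powr \<delta>) ^ k)"
    using b \<delta> powr_less_mono2[of \<delta> b 1] by (intro summable_mult summable_geometric) simp
  ultimately have "summable (\<lambda>k. prob (A k))"
    by (elim summable_comparison_test_ev[rotated]) simp
  then have "AE x in M. \<forall>\<^sub>F k in sequentially. x \<in> space M - A k"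
    by (intro borel_cantelli_AE1 Am) (auto simp: emeasure_eq_measure)
  then show ?thesis
  proof eventually_elim
    case (elim x)
    then show ?case
    proof eventually_elim
      case (elim k)
      then show ?case by (auto simp: A_def intro: hitting_time_le)
    qed
  qed
qed

text \<open>
  For \<open>b ^ k \<le> r < b ^ (k - 1)\<close> the hitting time of the ball of radius \<open>r\<close> is at most that of the
  smaller ball of radius \<open>b ^ k\<close>, and the measures of the two balls differ at most by the factor
  \<open>A\<close>. This factor and the rounding of the time bound cost an additive constant after taking
  logarithms, which the gap between \<open>\<gamma>'\<close> and \<open>\<gamma>\<close> absorbs because \<open>- ln (m r)\<close> tends to infinity.
\<close>

lemma Limsup_hitting_time_le:
  fixes M :: "'a::metric_space measure" and b A \<gamma> \<gamma>' :: real
  assumes M: "prob_space M" "sets M = sets borel"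
    and b: "0 < b" "b < 1" and "0 < A" and \<gamma>: "0 < \<gamma>'" "\<gamma>' < \<gamma>"
    and growth: "\<forall>\<^sub>F r in at_right 0. measure M (ball x\<^sub>0 r) \<le> A * measure M (ball x\<^sub>0 (b * r))"
    and pos: "\<forall>\<^sub>F r in at_right 0. 0 < measure M (ball x\<^sub>0 r)"
    and null: "((\<lambda>r. measure M (ball x\<^sub>0 r)) \<longlongrightarrow> 0) (at_right 0)"
    and hit: "\<forall>\<^sub>F k in sequentially.
      hitting_time T (b ^ k) x x\<^sub>0 \<le> enat (nat \<lceil>measure M (ball x\<^sub>0 (b ^ k)) powr - \<gamma>'\<rceil>)"
  shows "Limsup (at_right 0) (\<lambda>r. log_ext (ereal_of_enat (hitting_time T r x x\<^sub>0))
           / (- log_ext (ereal (measure M (ball x\<^sub>0 r))))) \<le> ereal \<gamma>"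
proof (rule Limsup_bounded)
  interpret prob_space M by (rule M)
  define m where "m r = measure M (ball x\<^sub>0 r)" for r
  have m_mono: "m r \<le> m s" if "r \<le> s" for r s
    unfolding m_def using that M(2) by (intro finite_measure_mono subset_ball) auto
  have lim: "filterlim (\<lambda>k. b ^ k) (at_right 0) sequentially"
    using b by (intro tendsto_imp_filterlim_at_right LIMSEQ_realpow_zero) auto
  obtain k\<^sub>0 where k\<^sub>0: "\<And>k. k\<^sub>0 \<le> k \<Longrightarrow> hitting_time T (b ^ k) x x\<^sub>0 \<le> enat (nat \<lceil>m (b ^ k) powr - \<gamma>'\<rceil>)
      \<and> m (b ^ k) \<le> A * m (b * b ^ k)"
    using eventually_conj[OF hit eventually_compose_filterlim[OF growth lim]]
    unfolding eventually_sequentially m_def by blast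
  (* Below c, the gap (\<gamma> - \<gamma>') * (- ln (m r)) exceeds the additive constant. *)
  define c where "c = exp (- (\<bar>ln 2 + \<gamma>' * ln A\<bar> / (\<gamma> - \<gamma>')))"
  have "\<forall>\<^sub>F r in at_right 0. m r < min 1 c"
    using null unfolding m_def by (rule order_tendstoD) (simp add: c_def)
  moreover have "\<forall>\<^sub>F r in at_right 0. r \<in> {0<..<b ^ k\<^sub>0}"
    using b by (intro eventually_at_right_real) simp
  ultimately show "\<forall>\<^sub>F r in at_right 0. log_ext (ereal_of_enat (hitting_time T r x x\<^sub>0))
           / (- log_ext (ereal (measure M (ball x\<^sub>0 r)))) \<le> ereal \<gamma>"
    using pos unfolding m_def[symmetric]
  proof eventually_elim
    case (elim r)
    have r: "0 < r" "r < b ^ k\<^sub>0" using elim(2) by auto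
    have "ln (m r) < ln c" using elim(1,3) by simp
    then have slack: "ln 2 + \<gamma>' * ln A \<le> (\<gamma> - \<gamma>') * - ln (m r)"
    proof -
      assume "ln (m r) < ln c"
      then have "\<bar>ln 2 + \<gamma>' * ln A\<bar> / (\<gamma> - \<gamma>') < - ln (m r)" by (simp add: c_def)
      then show ?thesis using \<gamma> by (simp add: divide_simps mult.commute)
    qed
    obtain k where k: "b ^ k \<le> r" "\<And>i. i < k \<Longrightarrow> r < b ^ i"
    proof -
      obtain i where "b ^ i < r" using real_arch_pow_inv[OF r(1) b(2)] by blast
      then show thesis
        using that[of "LEAST i. b ^ i \<le> r"] LeastI[of "\<lambda>i. b ^ i \<le> r" i]
          not_less_Least[of _ "\<lambda>i. b ^ i \<le> r"] by (auto simp: not_le)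
    qed
    have "k\<^sub>0 < k"
    proof (rule ccontr)
      assume "\<not> k\<^sub>0 < k"
      then have "b ^ k\<^sub>0 \<le> b ^ k" using b by (intro power_decreasing) auto
      then show False using k(1) r(2) by linarith
    qed
    then obtain j where j: "k = Suc j" "k\<^sub>0 \<le> j" by (cases k) auto
    define m' where "m' = m (b ^ k)"
    define N where "N = nat \<lceil>m' powr - \<gamma>'\<rceil>"
    have "m r \<le> m (b ^ j)" using k(2)[of j] j by (intro m_mono) auto
    also have "\<dots> \<le> A * m'" using k\<^sub>0[OF j(2)] j(1) by (simp add: m'_def)
    finally have mm': "m r \<le> A * m'" .
    then have m'0: "0 < m'" using elim(3) \<open>0 < A\<close> by (metis less_le_trans zero_less_mult_pos)
    have "m' \<le> m r" unfolding m'_def by (rule m_mono[OF k(1)])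
    then have m'1: "m' \<le> 1" using elim(1) by simp
    have "ln (m r) \<le> ln (A * m')" using mm' elim(3) by (simp add: ln_mono)
    then have ln_m': "- ln m' \<le> ln A - ln (m r)" using m'0 \<open>0 < A\<close> by (simp add: ln_mult)
    have "1 \<le> m' powr - \<gamma>'" using m'0 m'1 \<gamma> by (simp add: powr_minus powr_le1 one_le_inverse)
    then have N: "0 < N" "real N \<le> 2 * m' powr - \<gamma>'" unfolding N_def by linarith+
    have "hitting_time T r x x\<^sub>0 \<le> hitting_time T (b ^ k) x x\<^sub>0"
      using k(1) by (rule hitting_time_antimono)
    also have "\<dots> \<le> enat N" using k\<^sub>0[of k] \<open>k\<^sub>0 < k\<close> by (simp add: N_def m'_def)
    finally have "log_ext (ereal_of_enat (hitting_time T r x x\<^sub>0)) \<le> log_ext (ereal_of_enat (enat N))"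
      by (intro log_ext_mono) (simp only: ereal_of_enat_le_iff)
    also have "\<dots> = ereal (ln N)" using N by (simp add: log_ext_real)
    also have "ln N \<le> ln (2 * m' powr - \<gamma>')" using N by (intro ln_mono) auto
    also have "\<dots> = ln 2 + \<gamma>' * - ln m'" using m'0 by (simp add: ln_mult ln_powr)
    also have "\<dots> \<le> ln 2 + \<gamma>' * (ln A - ln (m r))"
      using ln_m' \<gamma> by (intro add_left_mono mult_left_mono) auto
    also have "\<dots> \<le> \<gamma> * - ln (m r)" using slack by (simp add: algebra_simps)
    finally have *: "log_ext (ereal_of_enat (hitting_time T r x x\<^sub>0)) \<le> ereal (\<gamma> * - ln (m r))"
      by simp
    have "0 < - ln (m r)" using elim(1,3) by simp
    then show ?case
      using * elim(3) by (simp add: log_ext_real ereal_divide_le_pos mult.commute)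
  qed
qed

text \<open>
  The constant depends continuously on the three parameters; all of them are perturbed by the same
  small amount \<open>t\<close>.
\<close>

lemma exponents_below:
  fixes du dl p \<gamma> :: real
  assumes "0 < dl" "0 < p" "1 + (2 * du + 2) / (dl * p) < \<gamma>"
  obtains D e q where "du < D" "0 < e" "e < dl" "0 < q" "q < p" "1 + (2 * D + 2) / (e * q) < \<gamma>"
proof -
  have "((\<lambda>t. 1 + (2 * (du + t) + 2) / ((dl - t) * (p - t))) \<longlongrightarrow>
      1 + (2 * (du + 0) + 2) / ((dl - 0) * (p - 0))) (at_right 0)"
    by (intro tendsto_add tendsto_divide tendsto_mult tendsto_diff tendsto_const tendsto_ident_at)
      (use assms(1,2) in simp)
  then have "\<forall>\<^sub>F t in at_right 0. 1 + (2 * (du + t) + 2) / ((dl - t) * (p - t)) < \<gamma>"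
    by (rule order_tendstoD) (use assms(3) in simp)
  moreover have "\<forall>\<^sub>F t::real in at_right 0. t \<in> {0<..<min dl p}"
    using assms by (intro eventually_at_right_real) simp
  ultimately have "\<forall>\<^sub>F t in at_right 0. 1 + (2 * (du + t) + 2) / ((dl - t) * (p - t)) < \<gamma> \<and> t \<in> {0<..<min dl p}"
    by (rule eventually_conj)
  then obtain t where "1 + (2 * (du + t) + 2) / ((dl - t) * (p - t)) < \<gamma>" "t \<in> {0<..<min dl p}"
    using eventually_happens'[OF trivial_limit_at_right_real] by blast
  then show thesis by (intro that[of "du + t" "dl - t" "p - t"]) auto
qed

section \<open>The upper bound for hitting times\<close>

theorem theorem5:
  fixes M :: "'a::metric_space measure" and T :: "'a \<Rightarrow> 'a" and x\<^sub>0 :: 'a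
    and C \<beta> p :: real
  assumes "separable_space (euclidean :: 'a topology)"
    and "prob_space M"
    and "sets M = sets borel"
    and "T \<in> measurable M M"
    and "distr M M T = M"
    and "measure M {x\<^sub>0} = 0"
    and "0 < lower_local_dim M x\<^sub>0"
    and "lower_local_dim M x\<^sub>0 \<le> upper_local_dim M x\<^sub>0"
    and "upper_local_dim M x\<^sub>0 < \<infinity>"
    and "C > 0"
    and "\<beta> > 0"
    and "\<exists>\<epsilon>>0. \<forall>r l. 0 < r \<and> r < \<epsilon> \<and> 0 < l \<and> l < \<epsilon> \<longrightarrow>
           measure M (ball x\<^sub>0 ((1 + l) * r)) \<le> measure M (ball x\<^sub>0 r) * (1 + C * l powr \<beta>)"
    and "p > 0"
    and "power_law_decay M T p"
  shows "AE x in M.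
    Limsup (at_right 0)
      (\<lambda>r::real. log_ext (ereal_of_enat (hitting_time T r x x\<^sub>0))
                 / (- log_ext (ereal (measure M (ball x\<^sub>0 r)))))
      \<le> 1 + (2 * upper_local_dim M x\<^sub>0 + 2) / (lower_local_dim M x\<^sub>0 * ereal p)"
proof -
  obtain dl where dl: "lower_local_dim M x\<^sub>0 = ereal dl"
    using assms(7-9) by (cases "lower_local_dim M x\<^sub>0") auto
  obtain du where du: "upper_local_dim M x\<^sub>0 = ereal du"
    using assms(7-9) by (cases "upper_local_dim M x\<^sub>0") auto
  have dl0: "0 < dl" using assms(7) by (simp add: dl zero_ereal_def)
  have du0: "0 < du" using assms(8) dl0 by (simp add: dl du)
  define B where "B = 1 + (2 * du + 2) / (dl * p)"
  have B: "1 + (2 * upper_local_dim M x\<^sub>0 + 2) / (lower_local_dim M x\<^sub>0 * ereal p) = ereal B"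
  proof -
    have "1 + (2 * ereal du + 2) / (ereal dl * ereal p)
        = ereal 1 + (ereal 2 * ereal du + ereal 2) / (ereal dl * ereal p)"
      by (simp only: one_ereal_def numeral_eq_ereal)
    also have "\<dots> = ereal B" using dl0 \<open>p > 0\<close> by (simp add: B_def)
    finally show ?thesis by (simp only: dl du)
  qed
  obtain \<Phi> where dec: "\<And>\<phi> \<psi> n. lipschitz_observable \<phi> \<Longrightarrow> lipschitz_observable \<psi> \<Longrightarrow>
      \<bar>(\<integral>x. \<phi> ((T ^^ n) x) * \<psi> x \<partial>M) - (\<integral>x. \<phi> x \<partial>M) * (\<integral>x. \<psi> x \<partial>M)\<bar>
        \<le> lipschitz_norm \<phi> * lipschitz_norm \<psi> * \<Phi> n"
    and rate: "((\<lambda>n. - log_ext (ereal (\<Phi> n)) / ereal (ln (real n))) \<longlongrightarrow> ereal p) sequentially"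
    using assms(14) unfolding power_law_decay_def by blast
  obtain \<epsilon> where "0 < \<epsilon>" and \<epsilon>: "\<forall>r l. 0 < r \<and> r < \<epsilon> \<and> 0 < l \<and> l < \<epsilon> \<longrightarrow>
      measure M (ball x\<^sub>0 ((1 + l) * r)) \<le> measure M (ball x\<^sub>0 r) * (1 + C * l powr \<beta>)"
    using assms(12) by blast
  obtain b A where b: "0 < b" "b < 1" and "0 < A"
    and growth: "\<forall>\<^sub>F r in at_right 0. measure M (ball x\<^sub>0 r) \<le> A * measure M (ball x\<^sub>0 (b * r))"
    using doubling_at_point[OF \<open>0 < \<epsilon>\<close> \<open>C > 0\<close> \<epsilon>] .
  define L where "L x = Limsup (at_right 0)
      (\<lambda>r::real. log_ext (ereal_of_enat (hitting_time T r x x\<^sub>0))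
                 / (- log_ext (ereal (measure M (ball x\<^sub>0 r)))))" for x
  have bound: "AE x in M. L x \<le> ereal \<gamma>" if \<gamma>: "B < \<gamma>" for \<gamma>
  proof -
    obtain D e q where Deq: "du < D" "0 < e" "e < dl" "0 < q" "q < p" "1 + (2 * D + 2) / (e * q) < \<gamma>"
      using exponents_below[OF dl0 \<open>p > 0\<close>, of du \<gamma>] \<gamma> unfolding B_def by blast
    have "(2 * D + 2) / (e * q) < \<gamma> - 1" using Deq(6) by simp
    then obtain \<kappa> where \<kappa>: "(2 * D + 2) / (e * q) < \<kappa>" "\<kappa> < \<gamma> - 1" using dense by blast
    have D0: "0 < D" using du0 Deq(1) by simp
    have between: "\<forall>\<^sub>F r in at_right 0.
        r powr D < measure M (ball x\<^sub>0 r) \<and> measure M (ball x\<^sub>0 r) < r powr e"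
      using Deq by (intro eventually_measure_ball_between) (simp_all add: dl du)
    have pos: "\<forall>\<^sub>F r in at_right 0. 0 < measure M (ball x\<^sub>0 r)"
      using between by eventually_elim (use order_le_less_trans[OF powr_ge_zero] in blast)
    have null: "((\<lambda>r. measure M (ball x\<^sub>0 r)) \<longlongrightarrow> 0) (at_right 0)"
    proof (rule order_tendstoI)
      fix c :: real assume "0 < c"
      show "\<forall>\<^sub>F r in at_right 0. measure M (ball x\<^sub>0 r) < c"
        using between eventually_powr_less[OF \<open>0 < e\<close> \<open>0 < c\<close>] by eventually_elim auto
    next
      fix c :: real assume "c < 0"
      then show "\<forall>\<^sub>F r in at_right 0. c < measure M (ball x\<^sub>0 r)"
        by (intro always_eventually allI) (rule less_le_trans, auto)
    qed
    obtain W \<delta> where W: "0 < \<delta>" "\<forall>\<^sub>F r in at_right 0.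
        measure M {x \<in> space M. \<forall>n\<in>{1..nat \<lceil>measure M (ball x\<^sub>0 r) powr - (1 + \<kappa>)\<rceil>}.
          (T ^^ n) x \<notin> ball x\<^sub>0 r} \<le> W * r powr \<delta>"
      by (rule eventually_prob_no_visit_le[OF assms(2-5) b \<open>0 < A\<close> Deq(2) D0 Deq(4) growth between
            dec eventually_rate_le[OF rate Deq(5)] \<kappa>(1)])
    have "0 < 1 + \<kappa>" using \<kappa>(1) D0 Deq by (smt (verit) divide_pos_pos mult_pos_pos)
    have "AE x in M. \<forall>\<^sub>F k in sequentially.
        hitting_time T (b ^ k) x x\<^sub>0 \<le> enat (nat \<lceil>measure M (ball x\<^sub>0 (b ^ k)) powr - (1 + \<kappa>)\<rceil>)"
      by (rule AE_hitting_time_geometric_le[OF assms(2-4) b W])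
    then show ?thesis
      unfolding L_def
      by eventually_elim
        (rule Limsup_hitting_time_le[OF assms(2,3) b \<open>0 < A\<close> \<open>0 < 1 + \<kappa>\<close> _ growth pos null],
          use \<kappa>(2) in auto)
  qed
  have "AE x in M. \<forall>n::nat. L x \<le> ereal (B + 1 / Suc n)"
    unfolding AE_all_countable by (intro allI bound) simp
  then have "AE x in M. L x \<le> ereal B"
  proof eventually_elim
    case (elim x)
    have "(\<lambda>n. ereal (B + 1 / Suc n)) \<longlonglongrightarrow> ereal (B + 0)"
      unfolding lim_ereal by (intro tendsto_add tendsto_const LIMSEQ_Suc[OF lim_1_over_n])
    then show ?case using LIMSEQ_le_const[of _ "ereal (B + 0)" "L x"] elim by auto
  qed
  then show ?thesis unfolding B L_def .
qed

end
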